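(* Let $X$ be a non-empty compact metrizable space, $T : X \to X$ a continuous map, and $\mathcal{C} \subset C(X)$. Let $H$ be the smallest closed $T$-invariant linear subspace of $C(X)$ containing $\mathcal{C}$. Then the following are equivalent: (i) $M_{\mathcal{C}}(X,T) = \varnothing$; (ii) there exists $g \in H$ such that $g(x) > 0$ for all $x \in X$. Furthermore, if $M_{\mathcal{C}}(X,T)$ is non-empty, then for every $\phi \in C(X)$ there exists $\mu^* \in M_{\mathcal{C}}(X,T)$ such that $$\int \phi \, d\mu^* = \sup_{\mu \in M_{\mathcal{C}}(X,T)} \int \phi \, d\mu.$$
   Context: $C(X)$ is the Banach space of continuous functions $X \to \mathbb{R}$ with the supremum norm. $M(X,T)$ is the set of $T$-invariant Borel probability measures on $X$. For $\mathcal{C} \subset C(X)$, $M_{\mathcal{C}}(X,T) = \{\mu \in M(X,T) : \int g \, d\mu = 0 \text{ for all } g \in \mathcal{C}\}$. A subset $H \subset C(X)$ is $T$-invariant if $f \circ T \in H$ for all $f \in H$. *)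

theory Defs
  imports "HOL-Probability.Probability"
begin

text \<open>
  The compact space is a whole type \<open>'a\<close> (hence non-empty). By compactness every continuous
  real function on it is bounded, so \<open>C(X)\<close> with the supremum norm is the type \<open>'a \<Rightarrow>\<^sub>C real\<close>.
\<close>

definition invariant_measures :: "('a::topological_space \<Rightarrow> 'a) \<Rightarrow> 'a measure set" where
  "invariant_measures T =
     {\<mu>. prob_space \<mu> \<and> sets \<mu> = sets borel \<and>
         (\<forall>A\<in>sets borel. emeasure \<mu> (T -` A) = emeasure \<mu> A)}"

definition constrained_measures ::
    "('a::topological_space \<Rightarrow> 'a) \<Rightarrow> ('a \<Rightarrow>\<^sub>C real) set \<Rightarrow> 'a measure set" where
  "constrained_measures T C =
     {\<mu> \<in> invariant_measures T. \<forall>g\<in>C. (\<integral>x. apply_bcontfun g x \<partial>\<mu>) = 0}"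

text \<open>
  The composition \<open>f \<circ> T\<close> is a plain function; that it lies in \<open>H\<close> means that it is the
  underlying function of an element of \<open>H\<close>.
\<close>

definition invariant_set ::
    "('a::topological_space \<Rightarrow> 'a) \<Rightarrow> ('a \<Rightarrow>\<^sub>C real) set \<Rightarrow> bool" where
  "invariant_set T H \<longleftrightarrow> (\<forall>f\<in>H. apply_bcontfun f \<circ> T \<in> apply_bcontfun ` H)"

definition closed_invariant_span ::
    "('a::topological_space \<Rightarrow> 'a) \<Rightarrow> ('a \<Rightarrow>\<^sub>C real) set \<Rightarrow> ('a \<Rightarrow>\<^sub>C real) set" where
  "closed_invariant_span T C = (\<lambda>V. subspace V \<and> closed V \<and> invariant_set T V) hull C"

text \<open>
  The family of these subspaces is closed under intersections (it contains the whole space when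
  \<open>T\<close> is continuous), so the hull is indeed its least member containing \<open>C\<close>.
\<close>

lemma closed_invariant_span_least:
  fixes T :: "'a::topological_space \<Rightarrow> 'a"
  assumes "continuous_on UNIV T"
  shows "subspace (closed_invariant_span T C)"
    and "closed (closed_invariant_span T C)"
    and "invariant_set T (closed_invariant_span T C)"
    and "C \<subseteq> closed_invariant_span T C"
    and "\<lbrakk>subspace V; closed V; invariant_set T V; C \<subseteq> V\<rbrakk> \<Longrightarrow> closed_invariant_span T C \<subseteq> V"
proof -
  define P where "P = (\<lambda>V. subspace V \<and> closed V \<and> invariant_set T V)"
  have comp: "\<exists>h :: 'a \<Rightarrow>\<^sub>C real. apply_bcontfun h = apply_bcontfun f \<circ> T" for f
  proof -
    have "continuous_on UNIV (apply_bcontfun f \<circ> T)"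
      using assms by (intro continuous_on_compose) (auto intro: continuous_on_apply_bcontfun)
    moreover have "bounded (range (apply_bcontfun f \<circ> T))"
      by (rule bounded_subset[OF bounded_apply_bcontfun[of f]]) auto
    ultimately show ?thesis
      by (intro exI[of _ "Bcontfun (apply_bcontfun f \<circ> T)"] Bcontfun_inverse)
        (auto simp: bcontfun_def)
  qed
  have inv: "invariant_set T V \<longleftrightarrow>
      (\<forall>f\<in>V. \<forall>h. apply_bcontfun h = apply_bcontfun f \<circ> T \<longrightarrow> h \<in> V)" for V
  proof -
    have "apply_bcontfun f \<circ> T \<in> apply_bcontfun ` V \<longleftrightarrow>
        (\<forall>h. apply_bcontfun h = apply_bcontfun f \<circ> T \<longrightarrow> h \<in> V)" for f :: "'a \<Rightarrow>\<^sub>C real"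
    proof -
      obtain h :: "'a \<Rightarrow>\<^sub>C real" where h: "apply_bcontfun h = apply_bcontfun f \<circ> T"
        using comp by blast
      show ?thesis
        unfolding h[symmetric] by (auto simp: apply_bcontfun_inject)
    qed
    then show ?thesis
      by (simp add: invariant_set_def)
  qed
  have inter: "P (\<Inter>F)" if "\<forall>V\<in>F. P V" for F
    unfolding P_def
  proof (intro conjI)
    show "subspace (\<Inter>F)" "closed (\<Inter>F)"
      using that by (auto simp: P_def intro: subspace_Inter)
    show "invariant_set T (\<Inter>F)"
      using that unfolding P_def inv by blast
  qed
  have "P (P hull C)"
    by (rule hull_in) (rule inter)
  then show "subspace (closed_invariant_span T C)" "closed (closed_invariant_span T C)"
    "invariant_set T (closed_invariant_span T C)"
    unfolding closed_invariant_span_def P_def by blast+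
  show "C \<subseteq> closed_invariant_span T C"
    unfolding closed_invariant_span_def by (rule hull_subset)
  show "\<lbrakk>subspace V; closed V; invariant_set T V; C \<subseteq> V\<rbrakk> \<Longrightarrow> closed_invariant_span T C \<subseteq> V"
    unfolding closed_invariant_span_def by (rule hull_minimal) auto
qed

end

theory Submission
  imports Defs
begin

text \<open>
  The easy direction integrates: for a constrained measure, the functions with vanishing integral
  form a closed \<open>T\<close>-invariant subspace containing \<open>C\<close>, so they include the closed invariant span
  \<open>H\<close>, and a strictly positive function cannot be among them.

  For the converse, let \<open>W\<close> consist of the sums of elements of \<open>H\<close> and of coboundaries
  \<open>f \<circ> T - f\<close>. A Borel probability measure is constrained if and only if its integral vanishes on
  \<open>W\<close> (\<open>constrained_measures_iff\<close>). If \<open>W\<close> contained a positive function, summing it along orbits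
  would cancel the coboundary up to a bounded term and leave a positive element of \<open>H\<close>
  (\<open>exists_positive_span\<close>). So if \<open>H\<close> has no positive element, neither has \<open>W\<close>, and the functional
  \<open>p f = inf {max (f + w) | w \<in> W}\<close> is finite and sublinear. The Hahn-Banach theorem
  (\<open>Hahn_Banach_sublinear\<close>) gives a linear functional \<open>\<Lambda> \<le> p\<close> with \<open>\<Lambda> \<phi> = p \<phi>\<close> for a chosen \<open>\<phi>\<close>.
  Being below \<open>p\<close> makes it positive, normalised and zero on \<open>W\<close>, so by the Riesz representation
  theorem (\<open>integral_representing_measure\<close>) it is the integral of a constrained measure.

  The same measure proves the last assertion. Every constrained measure \<open>\<mu>\<close> satisfies
  \<open>\<integral> \<phi> \<partial>\<mu> = \<integral> (\<phi> + w) \<partial>\<mu> \<le> max (\<phi> + w)\<close> for all \<open>w \<in> W\<close>, hence \<open>\<integral> \<phi> \<partial>\<mu> \<le> p \<phi>\<close>,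
  and the measure obtained from \<open>\<Lambda>\<close> attains this bound.

  The Riesz theorem is proved in the style of Daniell: the outer measure of a set is the infimum of
  \<open>sup (L (h k))\<close> over increasing sequences \<open>h\<close> of nonnegative continuous functions that reach the
  value 1 on the set. In a metrizable space open sets satisfy the Caratheodory condition for it
  (\<open>outer_split_open\<close>), and a layer-cake estimate identifies the integral with \<open>L\<close>. The
  Hahn-Banach theorem comes from the fact that minimal sublinear functionals are linear.
\<close>

section \<open>The Hahn-Banach theorem for sublinear functionals\<close>

definition sublinear :: "('b::real_vector \<Rightarrow> real) \<Rightarrow> bool" where
  "sublinear q \<longleftrightarrow> (\<forall>x y. q (x + y) \<le> q x + q y) \<and> (\<forall>c x. 0 \<le> c \<longrightarrow> q (c *\<^sub>R x) = c * q x)"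

lemma sublinear_add: "sublinear q \<Longrightarrow> q (x + y) \<le> q x + q y"
  and sublinear_scale: "sublinear q \<Longrightarrow> 0 \<le> c \<Longrightarrow> q (c *\<^sub>R x) = c * q x"
  by (auto simp: sublinear_def)

lemma sublinear_0: "sublinear q \<Longrightarrow> q 0 = 0"
  using sublinear_scale[of q 0 0] by simp

lemma sublinear_neg: "sublinear q \<Longrightarrow> - q (- x) \<le> q x"
  using sublinear_add[of q x "- x"] sublinear_0[of q] by simp

lemma sublinearI:
  fixes q :: "'b::real_vector \<Rightarrow> real"
  assumes add: "\<And>x y. q (x + y) \<le> q x + q y"
    and scale: "\<And>c x. 0 < c \<Longrightarrow> q (c *\<^sub>R x) \<le> c * q x"
    and zero: "q 0 = 0"
  shows "sublinear q"
  unfolding sublinear_def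
proof (intro conjI allI impI)
  fix c :: real and x assume "0 \<le> c"
  show "q (c *\<^sub>R x) = c * q x"
  proof (cases "c = 0")
    case True
    then show ?thesis by (simp add: zero)
  next
    case False
    with \<open>0 \<le> c\<close> have c: "0 < c" by simp
    have "q x \<le> inverse c * q (c *\<^sub>R x)"
      using scale[of "inverse c" "c *\<^sub>R x"] c by simp
    then have "c * q x \<le> q (c *\<^sub>R x)"
      using c by (simp add: field_simps)
    with scale[OF c, of x] show ?thesis by simp
  qed
qed (rule add)

text \<open>
  The infimum makes \<open>r (- y)\<close> as small as sublinearity permits, so that an odd functional
  below \<open>r\<close> takes the value \<open>q y\<close> at \<open>y\<close>. This is used twice: to prescribe the value of
  a dominated linear functional at one vector, and to show that a minimal sublinear functional is
  odd.
\<close>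
lemma sublinear_shift:
  fixes q :: "'b::real_vector \<Rightarrow> real"
  assumes q: "sublinear q"
  obtains r where "sublinear r" "\<And>x. r x \<le> q x" "r (- y) \<le> - q y"
proof -
  \<comment> \<open>The lower bound of the infimum uses that \<open>t * q y\<close> equals \<open>q (t *\<^sub>R y)\<close> for \<open>t \<ge> 0\<close>.\<close>
  define a where "a x t = q (x + t *\<^sub>R y) - t * q y" for x t
  define r where "r x = (INF t\<in>{0..}. a x t)" for x
  have lower: "- q (- x) \<le> a x t" if "0 \<le> t" for x t
    using sublinear_add[OF q, of "x + t *\<^sub>R y" "- x"] sublinear_scale[OF q that, of y]
    by (simp add: a_def)
  have le: "r x \<le> a x t" if "0 \<le> t" for x t
    unfolding r_def using that lower by (intro cINF_lower bdd_belowI2[of _ "- q (- x)"]) auto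
  have ge: "c \<le> r x" if "\<And>t. 0 \<le> t \<Longrightarrow> c \<le> a x t" for c x
    unfolding r_def using that by (intro cINF_greatest) auto
  have "sublinear r"
  proof (rule sublinearI)
    fix x z
    have "r (x + z) - a z t \<le> a x s" if "0 \<le> s" "0 \<le> t" for s t
    proof -
      have "r (x + z) \<le> a (x + z) (s + t)"
        using that by (intro le) auto
      also have "\<dots> \<le> a x s + a z t"
        using sublinear_add[OF q, of "x + s *\<^sub>R y" "z + t *\<^sub>R y"]
        by (simp add: a_def algebra_simps)
      finally show ?thesis by simp
    qed
    then have "r (x + z) - r x \<le> a z t" if "0 \<le> t" for t
      using ge[of "r (x + z) - a z t" x] that by fastforce
    then show "r (x + z) \<le> r x + r z"
      using ge[of "r (x + z) - r x" z] by fastforce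
  next
    fix c :: real and x assume c: "0 < c"
    have "r (c *\<^sub>R x) / c \<le> a x t" if t: "0 \<le> t" for t
    proof -
      have "r (c *\<^sub>R x) \<le> a (c *\<^sub>R x) (c * t)"
        using c t by (intro le) auto
      also have "\<dots> = c * a x t"
        using sublinear_scale[OF q, of c "x + t *\<^sub>R y"] c by (simp add: a_def algebra_simps)
      finally show ?thesis using c by (simp add: field_simps)
    qed
    from ge[OF this] show "r (c *\<^sub>R x) \<le> c * r x"
      using c by (simp add: field_simps)
  next
    have "a 0 t = 0" if "0 \<le> t" for t
      using sublinear_scale[OF q that, of y] by (simp add: a_def)
    then show "r 0 = 0"
      using le[of 0 0] ge[of 0 0] by force
  qed
  moreover have "r x \<le> q x" for x
    using le[of 0 x] by (simp add: a_def)
  moreover have "r (- y) \<le> - q y"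
    using le[of 1 "- y"] sublinear_0[OF q] by (simp add: a_def)
  ultimately show ?thesis by (rule that)
qed

text \<open>
  This supplies the bound that Zorn's lemma asks for. The pointwise infimum exists because
  \<open>q x \<ge> - q (- x) \<ge> - p (- x)\<close> for every sublinear \<open>q \<le> p\<close>. It is subadditive only because
  \<open>C\<close> is a chain: any two members can be replaced by the smaller one.
\<close>
lemma sublinear_Inf_chain:
  fixes p :: "'b::real_vector \<Rightarrow> real"
  assumes ne: "C \<noteq> {}"
    and C: "\<And>q. q \<in> C \<Longrightarrow> sublinear q \<and> q \<le> p"
    and chain: "\<And>q r. q \<in> C \<Longrightarrow> r \<in> C \<Longrightarrow> q \<le> r \<or> r \<le> q"
  obtains u where "sublinear u" "u \<le> p" "\<And>q. q \<in> C \<Longrightarrow> u \<le> q"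
proof -
  define u where "u x = (INF q\<in>C. q x)" for x
  have lower: "- p (- x) \<le> q x" if "q \<in> C" for q x
    using C[OF that] sublinear_neg[of q x] le_funD[of q p "- x"] by auto
  have le: "u x \<le> q x" if "q \<in> C" for q x
    unfolding u_def using that lower by (intro cINF_lower bdd_belowI2[of _ "- p (- x)"]) auto
  have ge: "c \<le> u x" if "\<And>q. q \<in> C \<Longrightarrow> c \<le> q x" for c x
    unfolding u_def using that ne by (intro cINF_greatest) auto
  have "sublinear u"
  proof (rule sublinearI)
    fix x z
    have "u (x + z) - r z \<le> q x" if "q \<in> C" "r \<in> C" for q r
    proof -
      obtain s where s: "s \<in> C" "s \<le> q" "s \<le> r"
        using chain[OF \<open>q \<in> C\<close> \<open>r \<in> C\<close>] \<open>q \<in> C\<close> \<open>r \<in> C\<close> by blast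
      have "u (x + z) \<le> s (x + z)" by (rule le) fact
      also have "\<dots> \<le> s x + s z" using C[OF s(1)] sublinear_add by blast
      also have "\<dots> \<le> q x + r z" by (intro add_mono le_funD[OF s(2)] le_funD[OF s(3)])
      finally show ?thesis by simp
    qed
    then have "u (x + z) - u x \<le> r z" if "r \<in> C" for r
      using ge[of "u (x + z) - r z" x] that by fastforce
    then show "u (x + z) \<le> u x + u z"
      using ge[of "u (x + z) - u x" z] by fastforce
  next
    fix c :: real and x assume c: "0 < c"
    have "u (c *\<^sub>R x) / c \<le> q x" if "q \<in> C" for q
      using le[OF that, of "c *\<^sub>R x"] C[OF that] sublinear_scale[of q c x] c
      by (simp add: field_simps)
    from ge[OF this] show "u (c *\<^sub>R x) \<le> c * u x"
      using c by (simp add: field_simps)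
  next
    have "q 0 = 0" if "q \<in> C" for q
      using C[OF that] sublinear_0 by blast
    then show "u 0 = 0"
      using ne le[of _ 0] ge[of 0 0] by fastforce
  qed
  moreover have "u \<le> p"
  proof -
    obtain q where "q \<in> C" using ne by blast
    then show ?thesis
      using C[of q] le[of q] by (auto simp: le_fun_def intro: order_trans)
  qed
  moreover have "u \<le> q" if "q \<in> C" for q
    using le[OF that] by (simp add: le_fun_def)
  ultimately show ?thesis by (rule that)
qed

text \<open>
  A minimal sublinear functional is linear: shifting it along \<open>x\<close> gives nothing smaller, which
  forces oddness, and an odd subadditive functional is additive. Starting Zorn's lemma below
  \<open>p\<close> shifted along \<open>y\<close>, and not below \<open>p\<close> itself, yields the equality at \<open>y\<close>.
\<close>
theorem Hahn_Banach_sublinear: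
  fixes p :: "'b::real_vector \<Rightarrow> real"
  assumes p: "sublinear p"
  obtains f where "linear f" "\<And>x. f x \<le> p x" "f y = p y"
proof -
  obtain p' where p': "sublinear p'" "\<And>x. p' x \<le> p x" "p' (- y) \<le> - p y"
    using sublinear_shift[OF p, of y] by blast
  define S where "S = {q. sublinear q \<and> q \<le> p'}"
  have "\<exists>m\<in>S. \<forall>q\<in>S. m \<ge> q \<longrightarrow> q = m"
  proof (rule predicate_Zorn[of S "(\<ge>)"])
    show "partial_order_on S (relation_of (\<ge>) S)"
      by (auto simp: partial_order_on_def preorder_on_def relation_of_def refl_on_def trans_def
          antisym_def)
  next
    fix C assume C: "C \<in> Chains (relation_of (\<ge>) S)"
    show "\<exists>u\<in>S. \<forall>q\<in>C. q \<ge> u"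
    proof (cases "C = {}")
      case True
      then show ?thesis using p' by (auto simp: S_def)
    next
      case False
      have "sublinear q \<and> q \<le> p'" if "q \<in> C" for q
        using C that by (auto simp: Chains_def relation_of_def S_def)
      moreover have "q \<le> r \<or> r \<le> q" if "q \<in> C" "r \<in> C" for q r
        using C that by (auto simp: Chains_def relation_of_def)
      ultimately show ?thesis
        by (rule sublinear_Inf_chain[OF False]) (auto simp: S_def)
    qed
  qed
  then obtain m where "m \<in> S" and min_S: "\<And>q. q \<in> S \<Longrightarrow> q \<le> m \<Longrightarrow> q = m"
    by blast
  then have m: "sublinear m" "m \<le> p'" by (auto simp: S_def)
  have min: "q = m" if "sublinear q" "q \<le> m" for q
    using min_S[of q] that order_trans[OF that(2) m(2)] by (simp add: S_def)
  have odd: "m (- x) = - m x" for x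
  proof -
    obtain r where r: "sublinear r" "\<And>z. r z \<le> m z" "r (- x) \<le> - m x"
      using sublinear_shift[OF m(1), of x] by blast
    then have "r = m" using min by (simp add: le_fun_def)
    with r(3) sublinear_neg[OF m(1), of "- x"] show ?thesis by simp
  qed
  have add: "m (x + z) = m x + m z" for x z
    using sublinear_add[OF m(1), of x z] sublinear_add[OF m(1), of "- x" "- z"]
      odd[of x] odd[of z] odd[of "x + z"] by simp
  have "linear m"
  proof (rule linearI)
    fix c :: real and x
    show "m (c *\<^sub>R x) = c *\<^sub>R m x"
      using sublinear_scale[OF m(1), of c x] sublinear_scale[OF m(1), of "- c" x] odd[of "c *\<^sub>R x"]
      by (cases "0 \<le> c") auto
  qed (rule add)
  moreover have le: "m x \<le> p x" for x
    using le_funD[OF m(2), of x] p'(2)[of x] by simp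
  moreover have "m y = p y"
    using le[of y] le_funD[OF m(2), of "- y"] p'(3) odd[of y] by simp
  ultimately show ?thesis by (rule that)
qed

section \<open>Continuous approximation of open sets\<close>

text \<open>
  Unless \<open>U\<close> is the whole space, the functions are \<open>min 1 (k * D)\<close>, where \<open>D\<close> is the
  distance to the complement of \<open>U\<close>.
  That they are eventually equal to 1 on \<open>U\<close>, and do not merely tend to 1, lets a
  product with \<open>g k\<close> keep the property of reaching the value 1; the construction of the
  representing measure relies on it.
\<close>
lemma metrizable_open_indicator_limit:
  fixes U :: "'a::topological_space set"
  assumes "metrizable_space (euclidean :: 'a topology)" "open U"
  obtains g :: "nat \<Rightarrow> 'a \<Rightarrow> real"
  where "\<And>k. continuous_on UNIV (g k)" "\<And>k x. 0 \<le> g k x" "\<And>k x. g k x \<le> 1"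
    "\<And>x. incseq (\<lambda>k. g k x)" "\<And>k x. x \<notin> U \<Longrightarrow> g k x = 0"
    "\<And>x. x \<in> U \<Longrightarrow> \<forall>\<^sub>F k in sequentially. g k x = 1"
proof (cases "U = UNIV")
  case True
  then show ?thesis by (intro that[of "\<lambda>k x. 1"]) (auto simp: incseq_def)
next
  case False
  obtain M :: "'a set" and d where "Metric_space M d" "euclidean = Metric_space.mtopology M d"
    using assms(1) by (auto simp: metrizable_space_def)
  moreover from this have "M = UNIV"
    by (metis Metric_space.topspace_mtopology topspace_euclidean)
  ultimately have M: "Metric_space UNIV d" and top: "euclidean = Metric_space.mtopology UNIV d"
    by simp_all
  interpret Metric_space UNIV d by (rule M)
  have open_iff: "open V \<longleftrightarrow> (\<forall>x\<in>V. \<exists>e>0. mball x e \<subseteq> V)" for V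
    using openin_mtopology[of V] unfolding top[symmetric] open_openin[symmetric]
    by (simp add: Ball_def)
  define D where "D x = (INF y\<in>- U. d x y)" for x
  have bdd: "bdd_below (d x ` A)" for x A
    by (intro bdd_belowI2[of _ 0]) simp
  have lip: "D x \<le> d x z + D z" for x z
  proof -
    have "D x - d x z \<le> d z y" if "y \<in> - U" for y
    proof -
      have "D x \<le> d x y" unfolding D_def by (intro cINF_lower bdd that)
      also have "\<dots> \<le> d x z + d z y" by (rule triangle) auto
      finally show ?thesis by simp
    qed
    then have "D x - d x z \<le> D z"
      unfolding D_def[of z] using False by (intro cINF_greatest) auto
    then show ?thesis by simp
  qed
  have D_nonneg: "0 \<le> D x" for x
    unfolding D_def using False by (intro cINF_greatest) auto
  have D_0: "D x = 0" if "x \<notin> U" for x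
  proof -
    have "D x \<le> d x x" unfolding D_def using that by (intro cINF_lower bdd) auto
    with D_nonneg[of x] show ?thesis by simp
  qed
  have D_pos: "0 < D x" if "x \<in> U" for x
  proof -
    obtain e where e: "e > 0" "mball x e \<subseteq> U"
      using iffD1[OF open_iff assms(2)] \<open>x \<in> U\<close> by blast
    have "e \<le> d x y" if "y \<in> - U" for y
      using subsetD[OF e(2), of y] that in_mball[of y x e] by (auto intro: leI)
    then have "e \<le> D x"
      unfolding D_def using False by (intro cINF_greatest) auto
    with e show ?thesis by simp
  qed
  have "continuous_on UNIV D"
    unfolding continuous_on_open_vimage[OF open_UNIV]
  proof (intro allI impI)
    fix B :: "real set" assume B: "open B"
    have "\<exists>e>0. mball x e \<subseteq> D -` B" if x: "D x \<in> B" for x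
    proof -
      obtain e where e: "e > 0" "ball (D x) e \<subseteq> B"
        using B x by (meson openE)
      have "D z \<in> B" if "d x z < e" for z
        using that lip[of x z] lip[of z x] e(2) commute[of x z]
        by (intro subsetD[OF e(2)]) (auto simp: dist_real_def)
      with e(1) show ?thesis by (intro exI[of _ e]) auto
    qed
    then show "open (D -` B \<inter> UNIV)" by (simp add: open_iff)
  qed
  show ?thesis
  proof (rule that[of "\<lambda>k x. min 1 (real k * D x)"])
    show "continuous_on UNIV (\<lambda>x. min 1 (real k * D x))" for k
      by (intro continuous_intros \<open>continuous_on UNIV D\<close>)
    show "incseq (\<lambda>k. min 1 (real k * D x))" for x
      using D_nonneg[of x] by (intro monoI min.mono mult_right_mono) auto
    show "\<forall>\<^sub>F k in sequentially. min 1 (real k * D x) = 1" if "x \<in> U" for x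
    proof -
      have "\<forall>\<^sub>F k in sequentially. 1 / D x \<le> real k"
        by (rule eventually_sequentiallyI[of "nat \<lceil>1 / D x\<rceil>"]) linarith
      then show ?thesis
        by eventually_elim (use D_pos[OF that] in \<open>auto simp: field_simps\<close>)
    qed
  qed (auto simp: D_nonneg D_0)
qed

text \<open>
  The compactness argument of Dini's theorem, in the one-sided form that gives the total mass of
  the representing measure its lower bound.
\<close>
lemma compact_increasing_cover:
  fixes h :: "nat \<Rightarrow> 'a::topological_space \<Rightarrow> real"
  assumes "compact (UNIV :: 'a set)" and cont: "\<And>k. continuous_on UNIV (h k)"
    and inc: "\<And>x. incseq (\<lambda>k. h k x)" and gt: "\<And>x. \<exists>k. c < h k x"
  obtains k where "\<And>x. c < h k x"
proof -
  have "open (h k -` {c<..})" for k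
    using cont[of k] by (simp add: continuous_on_open_vimage[OF open_UNIV])
  moreover have cov: "(UNIV :: 'a set) \<subseteq> (\<Union>k. h k -` {c<..})"
    using gt by auto
  ultimately obtain K where K: "finite K" "(UNIV :: 'a set) \<subseteq> (\<Union>k\<in>K. h k -` {c<..})"
    using compactE_image[OF assms(1), of UNIV "\<lambda>k. h k -` {c<..}"] cov by auto
  have "c < h (Max K) x" for x
  proof -
    obtain k where "k \<in> K" "c < h k x" using K(2) by auto
    moreover have "h k x \<le> h (Max K) x"
      using inc[of x] K(1) \<open>k \<in> K\<close> by (auto simp: incseq_def)
    ultimately show ?thesis by simp
  qed
  then show ?thesis by (rule that)
qed

section \<open>Riesz representation on a compact metrizable space\<close>

text \<open>
  The functional acts on plain functions so that pointwise products, minima and differences need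
  no repackaging; its values matter on continuous functions only.
\<close>
locale probability_functional =
  fixes L :: "('a::topological_space \<Rightarrow> real) \<Rightarrow> real"
  assumes compact: "compact (UNIV :: 'a set)"
    and metrizable: "metrizable_space (euclidean :: 'a topology)"
    and add: "continuous_on UNIV f \<Longrightarrow> continuous_on UNIV g \<Longrightarrow> L (\<lambda>x. f x + g x) = L f + L g"
    and scale: "continuous_on UNIV f \<Longrightarrow> L (\<lambda>x. c * f x) = c * L f"
    and nonneg: "continuous_on UNIV f \<Longrightarrow> (\<And>x. 0 \<le> f x) \<Longrightarrow> 0 \<le> L f"
    and one: "L (\<lambda>x. 1) = 1"
begin

lemma const: "L (\<lambda>x. c) = c"
  using scale[of "\<lambda>x. 1" c] one by simp

lemma diff:
  assumes "continuous_on UNIV f" "continuous_on UNIV g"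
  shows "L (\<lambda>x. f x - g x) = L f - L g"
  using add[of f "\<lambda>x. - 1 * g x"] scale[of g "-1"] assms by (auto intro!: continuous_intros)

lemma mono:
  assumes "continuous_on UNIV f" "continuous_on UNIV g" "\<And>x. f x \<le> g x"
  shows "L f \<le> L g"
  using nonneg[of "\<lambda>x. g x - f x"] diff[of g f] assms by (auto intro!: continuous_intros)

lemma sum:
  assumes "finite I" "\<And>i. i \<in> I \<Longrightarrow> continuous_on UNIV (f i)"
  shows "L (\<lambda>x. \<Sum>i\<in>I. f i x) = (\<Sum>i\<in>I. L (f i))"
  using assms
proof (induction I)
  case empty
  then show ?case by (simp add: const)
next
  case (insert i I)
  then show ?case by (simp add: add continuous_on_sum)
qed

text \<open>
  A set is covered by an increasing sequence of continuous functions, not by a series of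
  such functions. One sequence with pointwise products \<open>h k * g k\<close>
  then suffices to prove open sets measurable, and no double series has to be rearranged.
\<close>
definition covers :: "(nat \<Rightarrow> 'a \<Rightarrow> real) \<Rightarrow> 'a set \<Rightarrow> bool" where
  "covers h A \<longleftrightarrow> (\<forall>k. continuous_on UNIV (h k)) \<and> (\<forall>k x. 0 \<le> h k x) \<and>
     (\<forall>x. incseq (\<lambda>k. h k x)) \<and> (\<forall>x\<in>A. \<exists>k. 1 \<le> h k x)"

definition outer :: "'a set \<Rightarrow> ennreal" where
  "outer A = (INF h\<in>{h. covers h A}. SUP k. ennreal (L (h k)))"

lemma outer_lower: "covers h A \<Longrightarrow> outer A \<le> (SUP k. ennreal (L (h k)))"
  unfolding outer_def by (intro INF_lower) simp

lemma outer_le: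
  assumes "continuous_on UNIV f" "\<And>x. 0 \<le> f x" "\<And>x. x \<in> A \<Longrightarrow> 1 \<le> f x"
  shows "outer A \<le> ennreal (L f)"
  using outer_lower[of "\<lambda>k. f" A] assms by (auto simp: covers_def)

lemma outer_le_1: "outer A \<le> 1"
  using outer_le[of "\<lambda>x. 1" A] by (simp add: one)

lemma outer_empty: "outer {} = 0"
  using outer_le[of "\<lambda>x. 0" "{}"] by (simp add: const)

lemma outer_mono: "A \<subseteq> B \<Longrightarrow> outer A \<le> outer B"
  unfolding outer_def by (intro INF_superset_mono) (auto simp: covers_def)

text \<open>
  This is where compactness enters the construction of the measure: a cover of the whole space
  is uniformly above \<open>1 - e\<close> from some index on, so \<open>L\<close> is at least \<open>1 - e\<close> on its later members.
\<close>
lemma outer_UNIV: "outer UNIV = 1"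
proof (rule antisym[OF outer_le_1])
  show "1 \<le> outer UNIV"
    unfolding outer_def
  proof (rule INF_greatest)
    fix h assume "h \<in> {h. covers h UNIV}"
    then have h: "\<And>k. continuous_on UNIV (h k)" "\<And>x. incseq (\<lambda>k. h k x)" "\<And>x. \<exists>k. 1 \<le> h k x"
      "\<And>k x. 0 \<le> h k x"
      by (auto simp: covers_def)
    show "1 \<le> (SUP k. ennreal (L (h k)))"
    proof (rule ennreal_le_epsilon)
      fix e :: real assume e: "0 < e"
      obtain k where k: "\<And>x. 1 - e < h k x"
      proof (rule compact_increasing_cover[OF compact h(1,2), where c = "1 - e"])
        show "\<exists>k. 1 - e < h k x" for x
        proof -
          obtain k where "1 \<le> h k x" using h(3) by blast
          then show ?thesis using e by (intro exI[of _ k]) simp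
        qed
      qed blast
      have "1 - e \<le> L (h k)"
        using mono[of "\<lambda>x. 1 - e" "h k"] h k by (auto simp: const less_imp_le)
      then have "ennreal 1 \<le> ennreal (L (h k) + e)"
        by (intro ennreal_leI) simp
      also have "\<dots> = ennreal (L (h k)) + ennreal e"
        using e nonneg[OF h(1) h(4)] by (intro ennreal_plus) auto
      also have "\<dots> \<le> (SUP k. ennreal (L (h k))) + ennreal e"
        by (intro add_mono SUP_upper) auto
      finally show "1 \<le> (SUP k. ennreal (L (h k))) + ennreal e" by simp
    qed
  qed
qed

text \<open>
  Near-optimal covers \<open>h i\<close> of the sets \<open>A i\<close> combine into the one increasing sequence
  \<open>\<Sum>i<k. h i k\<close>, in which both the number of summands and the index inside them grow with \<open>k\<close>.
\<close>
lemma outer_subadditive: "outer (\<Union>i. A i) \<le> (\<Sum>i. outer (A i))" for A :: "nat \<Rightarrow> 'a set"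
proof (rule ennreal_le_epsilon)
  fix e :: real assume e: "0 < e"
  define w where "w i = ennreal (e * (1/2)^Suc i)" for i
  have w_pos: "0 < w i" for i
    using e by (simp add: w_def)
  have w_sum: "(\<Sum>i. w i) = ennreal e"
    unfolding w_def using e sums_mult[OF power_half_series, of e] by (intro suminf_ennreal_eq) auto
  have "\<exists>h. covers h (A i) \<and> (SUP k. ennreal (L (h k))) < outer (A i) + w i" for i
  proof -
    have "outer (A i) < outer (A i) + w i"
      using e outer_le_1[of "A i"] ennreal_add_left_cancel_less[of "outer (A i)" 0 "w i"] w_pos[of i]
      by (auto simp: top_unique)
    then show ?thesis
      unfolding outer_def[of "A i"] INF_less_iff by simp
  qed
  then obtain h where h: "\<And>i. covers (h i) (A i)"
    and le: "\<And>i. (SUP k. ennreal (L (h i k))) < outer (A i) + w i"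
    by metis
  have cont: "\<And>i k. continuous_on UNIV (h i k)" and nn: "\<And>i k x. 0 \<le> h i k x"
    and inc: "\<And>i x. incseq (\<lambda>k. h i k x)" and one: "\<And>i x. x \<in> A i \<Longrightarrow> \<exists>k. 1 \<le> h i k x"
    using h by (auto simp: covers_def)
  define H where "H k x = (\<Sum>i<k. h i k x)" for k x
  have "covers H (\<Union>i. A i)"
    unfolding covers_def
  proof (intro conjI allI ballI)
    show "continuous_on UNIV (H k)" for k
      unfolding H_def by (intro continuous_intros cont)
    show "0 \<le> H k x" for k x
      unfolding H_def by (intro sum_nonneg nn)
    show "incseq (\<lambda>k. H k x)" for x
    proof (rule incseq_SucI)
      fix k
      have "H k x \<le> (\<Sum>i<k. h i (Suc k) x)"
        unfolding H_def by (intro sum_mono incseq_SucD inc)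
      then show "H k x \<le> H (Suc k) x"
        using nn[of k "Suc k" x] by (simp add: H_def)
    qed
    fix x assume "x \<in> (\<Union>i. A i)"
    then obtain i where "x \<in> A i" by auto
    then obtain k where "1 \<le> h i k x" using one by blast
    also have "h i k x \<le> h i (max k (Suc i)) x"
      using inc[of i x] by (auto simp: incseq_def)
    also have "\<dots> \<le> H (max k (Suc i)) x"
      unfolding H_def by (rule member_le_sum) (auto simp: nn)
    finally show "\<exists>k. 1 \<le> H k x" by blast
  qed
  then have "outer (\<Union>i. A i) \<le> (SUP k. ennreal (L (H k)))"
    by (rule outer_lower)
  also have "\<dots> \<le> (\<Sum>i. SUP k. ennreal (L (h i k)))"
  proof (rule SUP_least)
    fix k
    have "L (H k) = (\<Sum>i<k. L (h i k))"
      unfolding H_def by (intro sum cont) auto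
    then have "ennreal (L (H k)) = (\<Sum>i<k. ennreal (L (h i k)))"
      using nonneg[OF cont nn] by (simp add: sum_ennreal)
    also have "\<dots> \<le> (\<Sum>i<k. SUP k. ennreal (L (h i k)))"
      by (intro sum_mono SUP_upper) auto
    also have "\<dots> \<le> (\<Sum>i. SUP k. ennreal (L (h i k)))"
      by (intro sum_le_suminf) auto
    finally show "ennreal (L (H k)) \<le> (\<Sum>i. SUP k. ennreal (L (h i k)))" .
  qed
  also have "\<dots> \<le> (\<Sum>i. outer (A i) + w i)"
    using le by (intro suminf_le less_imp_le) auto
  also have "\<dots> = (\<Sum>i. outer (A i)) + ennreal e"
    by (subst suminf_add[symmetric]) (auto simp: w_sum)
  finally show "outer (\<Union>i. A i) \<le> (\<Sum>i. outer (A i)) + ennreal e" .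
qed

lemma outer_measure_space_outer: "outer_measure_space UNIV outer"
  by (auto simp: outer_measure_space_def positive_def increasing_def countably_subadditive_def
      outer_empty outer_mono outer_subadditive)

text \<open>
  This is the Caratheodory condition for open sets. With \<open>g k\<close> increasing to the indicator of
  \<open>U\<close> and \<open>h\<close> a cover of \<open>A\<close>, the sequence \<open>h k * g k\<close> covers \<open>A \<inter> U\<close>, and for each fixed
  \<open>k\<close> the sequence \<open>h n * (1 - g k)\<close> in \<open>n\<close> covers \<open>A - U\<close>. Since \<open>h\<close> and \<open>g\<close> increase, the two
  functional values at \<open>k\<close> and \<open>n\<close> add up to at most the value of \<open>L\<close> at \<open>h (max k n)\<close>.
\<close>
lemma outer_split_open:
  assumes U: "open U"
  shows "outer (A \<inter> U) + outer (A - U) \<le> outer A"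
proof -
  obtain g :: "nat \<Rightarrow> 'a \<Rightarrow> real" where g: "\<And>k. continuous_on UNIV (g k)" "\<And>k x. 0 \<le> g k x"
    "\<And>k x. g k x \<le> 1" "\<And>x. incseq (\<lambda>k. g k x)" "\<And>k x. x \<notin> U \<Longrightarrow> g k x = 0"
    "\<And>x. x \<in> U \<Longrightarrow> \<forall>\<^sub>F k in sequentially. g k x = 1"
    using metrizable_open_indicator_limit[OF metrizable U] by blast
  show ?thesis
    unfolding outer_def[of A]
  proof (rule INF_greatest)
    fix h assume "h \<in> {h. covers h A}"
    then have h: "\<And>k. continuous_on UNIV (h k)" "\<And>k x. 0 \<le> h k x"
      "\<And>x. incseq (\<lambda>k. h k x)" "\<And>x. x \<in> A \<Longrightarrow> \<exists>k. 1 \<le> h k x"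
      by (auto simp: covers_def)
    let ?s = "SUP k. ennreal (L (h k))"
    have c1: "continuous_on UNIV (\<lambda>x. h n x * g k x)" for n k
      by (intro continuous_intros h g)
    have c2: "continuous_on UNIV (\<lambda>x. h n x * (1 - g k x))" for n k
      by (intro continuous_intros h g)
    have inner: "outer (A \<inter> U) \<le> (SUP k. ennreal (L (\<lambda>x. h k x * g k x)))"
    proof (rule outer_lower, unfold covers_def, intro conjI allI ballI c1)
      show "0 \<le> h k x * g k x" for k x
        by (simp add: h g)
      show "incseq (\<lambda>k. h k x * g k x)" for x
        by (intro monoI mult_mono h g monoD[OF h(3)] monoD[OF g(4)])
      fix x assume x: "x \<in> A \<inter> U"
      then obtain k where k: "1 \<le> h k x" using h by blast
      obtain n where n: "g j x = 1" if "n \<le> j" for j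
        using g(6)[of x] x by (auto simp: eventually_sequentially)
      have "1 \<le> h (max k n) x * g (max k n) x"
        using k n[of "max k n"] monoD[OF h(3), of k "max k n" x] by simp
      then show "\<exists>k. 1 \<le> h k x * g k x" by blast
    qed
    have outside: "outer (A - U) \<le> (SUP n. ennreal (L (\<lambda>x. h n x * (1 - g k x))))" for k
    proof (rule outer_lower, unfold covers_def, intro conjI allI ballI c2)
      show "0 \<le> h n x * (1 - g k x)" for n x
        by (simp add: h g)
      show "incseq (\<lambda>n. h n x * (1 - g k x))" for x
        using g(3) by (intro monoI mult_right_mono monoD[OF h(3)]) auto
      fix x assume "x \<in> A - U"
      then show "\<exists>n. 1 \<le> h n x * (1 - g k x)"
        using h g by simp
    qed
    have nn1: "0 \<le> L (\<lambda>x. h n x * g k x)" for n k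
      by (intro nonneg c1) (simp add: h g)
    have nn2: "0 \<le> L (\<lambda>x. h n x * (1 - g k x))" for n k
      by (intro nonneg c2) (simp add: h g)
    have split: "ennreal (L (\<lambda>x. h k x * g k x)) + ennreal (L (\<lambda>x. h n x * (1 - g k x))) \<le> ?s" for k n
    proof -
      let ?m = "max k n"
      have "L (\<lambda>x. h k x * g k x) + L (\<lambda>x. h n x * (1 - g k x))
          \<le> L (\<lambda>x. h ?m x * g k x) + L (\<lambda>x. h ?m x * (1 - g k x))"
        using h(3)
        by (intro add_mono mono c1 c2 mult_right_mono g) (auto simp: mono_def g)
      also have "\<dots> = L (h ?m)"
        by (subst add[OF c1 c2, symmetric]) (simp add: algebra_simps)
      finally have "ennreal (L (\<lambda>x. h k x * g k x)) + ennreal (L (\<lambda>x. h n x * (1 - g k x)))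
          \<le> ennreal (L (h ?m))"
        unfolding ennreal_plus[OF nn1 nn2, symmetric] by (rule ennreal_leI)
      also have "\<dots> \<le> ?s" by (rule SUP_upper) simp
      finally show ?thesis .
    qed
    have "outer (A \<inter> U) + outer (A - U) \<le>
        (SUP k. ennreal (L (\<lambda>x. h k x * g k x))) + outer (A - U)"
      by (intro add_right_mono inner)
    also have "\<dots> = (SUP k. ennreal (L (\<lambda>x. h k x * g k x)) + outer (A - U))"
      by (rule ennreal_SUP_add_left[symmetric]) simp
    also have "\<dots> \<le> ?s"
    proof (rule SUP_least)
      fix k
      have "ennreal (L (\<lambda>x. h k x * g k x)) + outer (A - U)
          \<le> ennreal (L (\<lambda>x. h k x * g k x)) + (SUP n. ennreal (L (\<lambda>x. h n x * (1 - g k x))))"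
        by (intro add_left_mono outside)
      also have "\<dots> = (SUP n. ennreal (L (\<lambda>x. h k x * g k x)) + ennreal (L (\<lambda>x. h n x * (1 - g k x))))"
        by (rule ennreal_SUP_add_right) simp
      also have "\<dots> \<le> ?s"
        by (intro SUP_least split)
      finally show "ennreal (L (\<lambda>x. h k x * g k x)) + outer (A - U) \<le> ?s" .
    qed
    finally show "outer (A \<inter> U) + outer (A - U) \<le> ?s" .
  qed
qed

lemma outer_measure_space_borel: "measure_space UNIV (sets borel) outer"
proof -
  interpret sigma_algebra "UNIV :: 'a set" UNIV
    using sigma_algebra_Pow[of UNIV] by simp
  have ms: "measure_space UNIV (lambda_system UNIV UNIV outer) outer"
    by (rule caratheodory_lemma[OF outer_measure_space_outer])
  then have sa: "sigma_algebra UNIV (lambda_system UNIV UNIV outer)"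
    by (simp add: measure_space_def)
  have "U \<in> lambda_system UNIV UNIV outer" if "open U" for U
  proof -
    have "outer A \<le> outer (A \<inter> U) + outer (A - U)" for A
    proof -
      define B where "B i = (if i = 0 then A \<inter> U else if i = 1 then A - U else {})" for i :: nat
      have "(\<Union>i. B i) = A"
      proof
        show "A \<subseteq> (\<Union>i. B i)"
        proof
          fix x assume "x \<in> A"
          then have "x \<in> B 0 \<or> x \<in> B 1" by (auto simp: B_def)
          then show "x \<in> (\<Union>i. B i)" by blast
        qed
      qed (auto simp: B_def split: if_splits)
      then have "outer A \<le> (\<Sum>i. outer (B i))"
        using outer_subadditive[of B] by simp
      also have "\<dots> = (\<Sum>i\<in>{0, 1}. outer (B i))"
        by (rule suminf_finite) (auto simp: B_def outer_empty)
      finally show ?thesis by (simp add: B_def)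
    qed
    then show ?thesis
      using outer_split_open[OF that] by (auto simp: lambda_system_eq intro: antisym)
  qed
  then have "sets borel \<subseteq> lambda_system UNIV UNIV outer"
    unfolding sets_borel by (intro sigma_algebra.sigma_sets_subset[OF sa]) auto
  with ms show ?thesis
    using sets.sigma_algebra_axioms[of "borel :: 'a measure"]
    by (auto simp: measure_space_def positive_def countably_additive_def)
qed

definition representing_measure :: "'a measure" where
  "representing_measure = measure_of UNIV (sets borel) outer"

lemma sets_representing_measure [measurable_cong]: "sets representing_measure = sets borel"
  unfolding representing_measure_def using sets.sigma_sets_eq[of "borel :: 'a measure"] by simp

lemma emeasure_representing_measure: "A \<in> sets borel \<Longrightarrow> emeasure representing_measure A = outer A"
  unfolding representing_measure_def using outer_measure_space_borel sets.sigma_algebra_axioms[of "borel :: 'a measure"]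
  by (intro emeasure_measure_of_sigma) (auto simp: measure_space_def)

lemma prob_space_representing_measure: "prob_space representing_measure"
  by (rule prob_spaceI) (simp add: emeasure_representing_measure outer_UNIV sets_eq_imp_space_eq[OF sets_representing_measure])

text \<open>
  A layer-cake estimate. The slice \<open>F i\<close> of \<open>f\<close> between the heights \<open>i / N\<close> and
  \<open>(i + 1) / N\<close> satisfies \<open>N * F i \<ge> 1\<close> where \<open>f\<close> is at least \<open>(i + 1) / N\<close>, so
  \<open>N * L (F i)\<close> bounds the measure of that set. Summed over \<open>i\<close>, these bounds give
  \<open>L f\<close> on one side and the integral, up to \<open>1 / N\<close>, on the other.
\<close>
lemma integral_le_functional_unit:
  assumes f: "continuous_on UNIV f" "\<And>x. 0 \<le> f x" "\<And>x. f x \<le> 1"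
  shows "(\<integral>x. f x \<partial>representing_measure) \<le> L f"
proof (rule field_le_epsilon)
  interpret prob_space representing_measure by (rule prob_space_representing_measure)
  fix e :: real assume "0 < e"
  then obtain N :: nat where N: "N > 0" "1 / real N < e"
    using nat_approx_posE[of e] by (metis zero_less_Suc)
  define F where "F i x = min (f x) (real (Suc i) / N) - min (f x) (real i / N)" for i x
  define S where "S i = {x. real (Suc i) / N \<le> f x}" for i
  have contF: "continuous_on UNIV (F i)" for i
    unfolding F_def by (intro continuous_intros f)
  have F_nn: "0 \<le> F i x" for i x
    unfolding F_def using N by (auto simp: min_def field_simps)
  have fm [measurable]: "f \<in> borel_measurable borel"
    using f(1) by (rule borel_measurable_continuous_onI)
  have S [measurable]: "S i \<in> sets representing_measure" for i
    unfolding S_def sets_representing_measure by measurable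
  have sumF: "(\<Sum>i<N. F i x) = f x" for x
    unfolding F_def using sum_lessThan_telescope[of "\<lambda>i. min (f x) (real i / N)" N] f N by simp
  have meas_S: "measure representing_measure (S i) \<le> N * L (F i)" for i
  proof -
    have "emeasure representing_measure (S i) \<le> ennreal (L (\<lambda>x. N * F i x))"
      unfolding emeasure_representing_measure[OF S[unfolded sets_representing_measure]]
    proof (rule outer_le)
      show "continuous_on UNIV (\<lambda>x. N * F i x)" by (intro continuous_intros contF)
      show "0 \<le> N * F i x" for x by (simp add: F_nn)
      show "1 \<le> N * F i x" if "x \<in> S i" for x
        using that N by (auto simp: S_def F_def min_def field_simps)
    qed
    moreover have "0 \<le> N * L (F i)" using nonneg[OF contF F_nn] by simp
    ultimately show ?thesis
      by (simp add: emeasure_eq_measure scale[OF contF])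
  qed
  have pw: "f x \<le> 1 / N + (\<Sum>i<N. indicator (S i) x / N)" for x
  proof -
    \<comment> \<open>Bounding each slice by the set above its lower height loses one index; the shift costs \<open>b 0 = 1 / N\<close>.\<close>
    define b :: "nat \<Rightarrow> real" where "b i = (if real i / N \<le> f x then 1 / N else 0)" for i
    have "f x = (\<Sum>i<N. F i x)" by (simp add: sumF)
    also have "\<dots> \<le> (\<Sum>i<N. b i)"
      using N by (intro sum_mono) (auto simp: b_def F_def min_def field_simps)
    also have "\<dots> \<le> (\<Sum>i<Suc N. b i)" by (simp add: b_def)
    also have "\<dots> = b 0 + (\<Sum>i<N. b (Suc i))" by (rule sum.lessThan_Suc_shift)
    also have "\<dots> = 1 / N + (\<Sum>i<N. indicator (S i) x / N)"
      using f(2) by (auto simp: b_def S_def indicator_def intro!: sum.cong)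
    finally show ?thesis .
  qed
  have "(\<integral>x. f x \<partial>representing_measure) \<le> (\<integral>x. 1 / N + (\<Sum>i<N. indicator (S i) x / N) \<partial>representing_measure)"
  proof (rule integral_mono)
    show "integrable representing_measure f"
      using f by (intro integrable_const_bound[of _ 1]) auto
  qed (auto intro!: pw Bochner_Integration.integrable_sum integrable_divide integrable_real_indicator simp: emeasure_eq_measure)
  also have "\<dots> = 1 / N + (\<Sum>i<N. measure representing_measure (S i) / N)"
    by (subst Bochner_Integration.integral_add)
      (auto simp: prob_space emeasure_eq_measure
        intro!: Bochner_Integration.integrable_sum integrable_divide integrable_real_indicator)
  also have "\<dots> \<le> 1 / N + (\<Sum>i<N. L (F i))"
    using meas_S N by (intro add_left_mono sum_mono) (simp add: field_simps)
  also have "\<dots> = 1 / N + L f"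
    using sum[of "{..<N}" F] contF by (simp add: sumF)
  finally show "(\<integral>x. f x \<partial>representing_measure) \<le> L f + e" using N by simp
qed

lemma integrable_representing_measure:
  fixes f :: "'a \<Rightarrow> real"
  assumes "continuous_on UNIV f"
  shows "integrable representing_measure f"
proof -
  interpret prob_space representing_measure by (rule prob_space_representing_measure)
  have "bounded (range f)"
    using assms compact by (intro compact_imp_bounded compact_continuous_image)
  then obtain B where B: "\<And>x. norm (f x) \<le> B" by (auto simp: bounded_iff)
  have "f \<in> borel_measurable representing_measure"
    using borel_measurable_continuous_onI[OF assms] by (simp cong: measurable_cong_sets add: sets_representing_measure)
  then show ?thesis
    by (rule integrable_const_bound[rotated]) (use B in auto)
qed

text \<open>
  One inequality suffices, since it can be applied to \<open>- f\<close> as well. An affine change of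
  variable brings any continuous function, bounded by compactness, into the unit interval.
\<close>
theorem integral_representing_measure:
  assumes f: "continuous_on UNIV f"
  shows "(\<integral>x. f x \<partial>representing_measure) = L f"
proof -
  interpret prob_space representing_measure by (rule prob_space_representing_measure)
  have le: "(\<integral>x. f x \<partial>representing_measure) \<le> L f" if f: "continuous_on UNIV f" for f
  proof -
    have "bounded (range f)"
      using f compact by (intro compact_imp_bounded compact_continuous_image)
    then obtain B where B: "B > 0" "\<And>x. \<bar>f x\<bar> \<le> B" by (auto simp: bounded_pos)
    \<comment> \<open>\<open>1/2 + c * f\<close> takes values in the unit interval.\<close>
    define c where "c = 1 / (2 * B)"
    have c: "0 < c" using B(1) by (simp add: c_def)
    have cf: "\<bar>c * f x\<bar> \<le> 1/2" for x
      using B(2)[of x] B(1) by (simp add: c_def abs_mult field_simps)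
    have "(\<integral>x. 1/2 + c * f x \<partial>representing_measure) \<le> L (\<lambda>x. 1/2 + c * f x)"
    proof (rule integral_le_functional_unit)
      show "continuous_on UNIV (\<lambda>x. 1/2 + c * f x)" by (intro continuous_intros f)
      show "0 \<le> 1/2 + c * f x" "1/2 + c * f x \<le> 1" for x
        using cf[of x] by (auto simp: abs_le_iff)
    qed
    moreover have "L (\<lambda>x. 1/2 + c * f x) = 1/2 + c * L f"
      using add[of "\<lambda>x. 1/2" "\<lambda>x. c * f x"] f by (simp add: const scale[OF f] continuous_on_mult_left)
    moreover have "(\<integral>x. 1/2 + c * f x \<partial>representing_measure) = 1/2 + c * (\<integral>x. f x \<partial>representing_measure)"
      using integrable_representing_measure[OF f] by (subst Bochner_Integration.integral_add) (auto simp: prob_space)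
    ultimately show ?thesis using c by simp
  qed
  have "(\<integral>x. - 1 * f x \<partial>representing_measure) \<le> L (\<lambda>x. - 1 * f x)"
    by (intro le continuous_intros f)
  then have "L f \<le> (\<integral>x. f x \<partial>representing_measure)"
    using scale[OF f, of "- 1"] integrable_representing_measure[OF f] by simp
  with le[OF f] show ?thesis by simp
qed

end

section \<open>Probability measures annihilating a subspace\<close>

lemma apply_Bcontfun_compact:
  fixes f :: "'a::topological_space \<Rightarrow> 'b::metric_space"
  assumes "compact (UNIV :: 'a set)" "continuous_on UNIV f"
  shows "apply_bcontfun (Bcontfun f) = f"
  using assms
  by (intro Bcontfun_inverse) (auto simp: bcontfun_def intro!: compact_imp_bounded compact_continuous_image)

lemma abs_apply_bcontfun_le: "\<bar>apply_bcontfun f x\<bar> \<le> norm f" for f :: "'a::topological_space \<Rightarrow>\<^sub>C real"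
  using norm_bounded[of f x] by simp

text \<open>
  No member of \<open>W\<close> is strictly positive. This is clearly necessary for a probability measure with
  vanishing integrals on \<open>W\<close>; the theorem \<open>exists_measure\<close> below shows that it is sufficient on
  a compact metrizable space.
\<close>
locale nonpositive_subspace =
  fixes W :: "('a::topological_space \<Rightarrow>\<^sub>C real) set"
  assumes subspace: "subspace W"
    and no_pos: "w \<in> W \<Longrightarrow> \<exists>x. apply_bcontfun w x \<le> 0"
begin

text \<open>
  On a compact space this is the infimum of \<open>max (f + w)\<close> over \<open>w \<in> W\<close>, the best upper bound
  for the integral of \<open>f\<close> that can be read off from the vanishing of the integrals on \<open>W\<close>.
\<close>
definition upper :: "('a \<Rightarrow>\<^sub>C real) \<Rightarrow> real" where
  "upper f = Inf {c. \<exists>w\<in>W. \<forall>x. apply_bcontfun f x + apply_bcontfun w x \<le> c}"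

text \<open>
  This is where the absence of positive functions is used: it keeps \<open>upper\<close> finite. A bound
  below \<open>- norm f\<close> would make \<open>- w\<close> strictly positive.
\<close>
lemma bound_ge:
  assumes "w \<in> W" "\<And>x. apply_bcontfun f x + apply_bcontfun w x \<le> c"
  shows "- norm f \<le> c"
proof -
  obtain x where "apply_bcontfun (- w) x \<le> 0"
    using no_pos[of "- w"] subspace_neg[OF subspace assms(1)] by blast
  with assms(2)[of x] abs_apply_bcontfun_le[of f x] show ?thesis by simp
qed

lemma upper_le:
  assumes "w \<in> W" "\<And>x. apply_bcontfun f x + apply_bcontfun w x \<le> c"
  shows "upper f \<le> c"
  unfolding upper_def
proof (rule cInf_lower)
  show "bdd_below {c. \<exists>w\<in>W. \<forall>x. apply_bcontfun f x + apply_bcontfun w x \<le> c}"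
    using bound_ge[of _ f] by (intro bdd_belowI[of _ "- norm f"]) auto
qed (use assms in auto)

lemma upper_ge:
  assumes "\<And>w c. w \<in> W \<Longrightarrow> (\<And>x. apply_bcontfun f x + apply_bcontfun w x \<le> c) \<Longrightarrow> b \<le> c"
  shows "b \<le> upper f"
  unfolding upper_def
proof (rule cInf_greatest)
  have "\<forall>x. apply_bcontfun f x + apply_bcontfun 0 x \<le> norm f"
    using abs_apply_bcontfun_le[of f] by (auto simp: abs_le_iff)
  then show "{c. \<exists>w\<in>W. \<forall>x. apply_bcontfun f x + apply_bcontfun w x \<le> c} \<noteq> {}"
    using subspace_0[OF subspace] by blast
qed (use assms in blast)

lemma sublinear_upper: "sublinear upper"
proof (rule sublinearI)
  fix f g
  have "upper (f + g) - c' \<le> c" if v: "v \<in> W" "\<And>x. apply_bcontfun f x + apply_bcontfun v x \<le> c"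
    and w: "w \<in> W" "\<And>x. apply_bcontfun g x + apply_bcontfun w x \<le> c'" for v w c c'
  proof -
    have "apply_bcontfun (f + g) x + apply_bcontfun (v + w) x \<le> c + c'" for x
      using v(2)[of x] w(2)[of x] by simp
    from upper_le[OF subspace_add[OF subspace v(1) w(1)] this] show ?thesis by simp
  qed
  then have "upper (f + g) - c' \<le> upper f"
    if "w \<in> W" "\<And>x. apply_bcontfun g x + apply_bcontfun w x \<le> c'" for w c'
    using that by (intro upper_ge) blast
  then have "upper (f + g) - upper f \<le> upper g"
    by (intro upper_ge) (simp add: diff_le_eq add.commute)
  then show "upper (f + g) \<le> upper f + upper g" by simp
next
  fix c :: real and f assume c: "0 < c"
  have "upper (c *\<^sub>R f) / c \<le> b" if w: "w \<in> W" "\<And>x. apply_bcontfun f x + apply_bcontfun w x \<le> b" for w b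
  proof -
    have "apply_bcontfun (c *\<^sub>R f) x + apply_bcontfun (c *\<^sub>R w) x \<le> c * b" for x
      using mult_left_mono[OF w(2)[of x], of c] c by (simp add: algebra_simps)
    from upper_le[OF subspace_scale[OF subspace w(1)] this] show ?thesis
      using c by (simp add: field_simps)
  qed
  then have "upper (c *\<^sub>R f) / c \<le> upper f" by (rule upper_ge)
  then show "upper (c *\<^sub>R f) \<le> c * upper f"
    using c by (simp add: field_simps)
next
  have "upper 0 \<le> 0"
    by (rule upper_le[OF subspace_0[OF subspace]]) simp
  moreover have "0 \<le> upper 0"
    by (rule upper_ge) (use bound_ge[of _ 0] in auto)
  ultimately show "upper 0 = 0" by simp
qed

text \<open>
  A linear functional below \<open>upper\<close> has all the required properties at once: it is positive
  and normalised because \<open>upper f \<le> sup f\<close>, and it vanishes on \<open>W\<close> because \<open>upper\<close> is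
  nonpositive on \<open>W\<close> and \<open>W\<close> is symmetric. Prescribing its value at \<open>\<phi>\<close> as
  \<open>upper \<phi>\<close> makes the measure maximise the integral of \<open>\<phi>\<close>, so that no compactness of a
  space of measures is needed.
\<close>
theorem exists_measure:
  assumes compact: "compact (UNIV :: 'a set)"
    and metrizable: "metrizable_space (euclidean :: 'a topology)"
  obtains \<mu> :: "'a measure" where "prob_space \<mu>" "sets \<mu> = sets borel"
    "\<And>w. w \<in> W \<Longrightarrow> (\<integral>x. apply_bcontfun w x \<partial>\<mu>) = 0"
    "(\<integral>x. apply_bcontfun \<phi> x \<partial>\<mu>) = upper \<phi>"
proof -
  obtain \<Lambda> where lin: "linear \<Lambda>" and le: "\<And>f. \<Lambda> f \<le> upper f" and eq: "\<Lambda> \<phi> = upper \<phi>"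
    using Hahn_Banach_sublinear[OF sublinear_upper, of \<phi>] by blast
  note app = apply_Bcontfun_compact[OF compact]
  have bound: "\<Lambda> f \<le> c" if "\<And>x. apply_bcontfun f x \<le> c" for f c
    using le[of f] upper_le[OF subspace_0[OF subspace], of f c] that by simp
  define L where "L f = \<Lambda> (Bcontfun f)" for f
  interpret probability_functional L
  proof
    fix f g :: "'a \<Rightarrow> real"
    assume f: "continuous_on UNIV f"
    {
      assume g: "continuous_on UNIV g"
      have "Bcontfun (\<lambda>x. f x + g x) = Bcontfun f + Bcontfun g"
        by (rule bcontfun_eqI) (simp add: app f g continuous_on_add)
      then show "L (\<lambda>x. f x + g x) = L f + L g"
        by (simp add: L_def linear_add[OF lin])
    }
    show "L (\<lambda>x. c * f x) = c * L f" for c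
    proof -
      have "Bcontfun (\<lambda>x. c * f x) = c *\<^sub>R Bcontfun f"
        by (rule bcontfun_eqI) (simp add: app f continuous_on_mult_left)
      then show ?thesis
        by (simp add: L_def linear_scale[OF lin])
    qed
    {
      assume "\<And>x. 0 \<le> f x"
      then have "\<Lambda> (- Bcontfun f) \<le> 0"
        by (intro bound) (simp add: app f)
      then show "0 \<le> L f"
        by (simp add: L_def linear_neg[OF lin])
    }
  next
    have app_1: "apply_bcontfun (Bcontfun (\<lambda>x. 1 :: real)) = (\<lambda>x::'a. 1)"
      by (rule app) simp
    have "\<Lambda> (Bcontfun (\<lambda>x. 1)) \<le> 1" "\<Lambda> (- Bcontfun (\<lambda>x. 1)) \<le> - 1"
      by (auto intro!: bound simp: app_1)
    then show "L (\<lambda>x. 1) = 1"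
      by (simp add: L_def linear_neg[OF lin])
  qed (rule compact, rule metrizable)
  have int: "(\<integral>x. apply_bcontfun f x \<partial>representing_measure) = \<Lambda> f" for f
    using integral_representing_measure[of "apply_bcontfun f"] by (simp add: L_def apply_bcontfun_inverse)
  have nonpos: "\<Lambda> w \<le> 0" if "w \<in> W" for w
    using le[of w] upper_le[OF subspace_neg[OF subspace that], of w 0] by simp
  have "\<Lambda> w = 0" if "w \<in> W" for w
    using nonpos[OF that] nonpos[OF subspace_neg[OF subspace that]] by (simp add: linear_neg[OF lin])
  then show ?thesis
    using prob_space_representing_measure sets_representing_measure eq by (intro that[of representing_measure]) (auto simp: int)
qed

lemma integral_le_upper:
  assumes \<mu>: "prob_space \<mu>"
    and int: "\<And>f :: 'a \<Rightarrow>\<^sub>C real. integrable \<mu> (apply_bcontfun f)"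
    and zero: "\<And>w. w \<in> W \<Longrightarrow> (\<integral>x. apply_bcontfun w x \<partial>\<mu>) = 0"
  shows "(\<integral>x. apply_bcontfun f x \<partial>\<mu>) \<le> upper f"
proof (rule upper_ge)
  interpret prob_space \<mu> by fact
  fix w c assume w: "w \<in> W" "\<And>x. apply_bcontfun f x + apply_bcontfun w x \<le> c"
  have "(\<integral>x. apply_bcontfun f x \<partial>\<mu>) = (\<integral>x. apply_bcontfun f x + apply_bcontfun w x \<partial>\<mu>)"
    using zero[OF w(1)] by (simp add: int)
  also have "\<dots> \<le> c"
    using integral_le_const[of "\<lambda>x. apply_bcontfun f x + apply_bcontfun w x" c] w(2)
    by (simp add: int)
  finally show "(\<integral>x. apply_bcontfun f x \<partial>\<mu>) \<le> c" .
qed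

end

section \<open>Integrals of continuous functions determine the measure\<close>

lemma integrable_bcontfun:
  fixes f :: "'a::topological_space \<Rightarrow>\<^sub>C real"
  assumes "finite_measure \<mu>" "sets \<mu> = sets borel"
  shows "integrable \<mu> (apply_bcontfun f)"
proof -
  interpret finite_measure \<mu> by fact
  have "apply_bcontfun f \<in> borel_measurable \<mu>"
    using assms(2) by (simp cong: measurable_cong_sets add: borel_measurable_continuous_onI)
  then show ?thesis
    using abs_apply_bcontfun_le[of f] by (intro integrable_const_bound[of _ "norm f"]) auto
qed

text \<open>
  Indicators of open sets are limits of bounded continuous functions, and the open sets form an
  intersection-stable generator of the Borel sets.
\<close>
lemma prob_measure_eqI:
  fixes \<mu> \<nu> :: "'a::topological_space measure"
  assumes metrizable: "metrizable_space (euclidean :: 'a topology)"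
    and \<mu>: "prob_space \<mu>" "sets \<mu> = sets borel"
    and \<nu>: "prob_space \<nu>" "sets \<nu> = sets borel"
    and eq: "\<And>f :: 'a \<Rightarrow>\<^sub>C real. (\<integral>x. apply_bcontfun f x \<partial>\<mu>) = (\<integral>x. apply_bcontfun f x \<partial>\<nu>)"
  shows "\<mu> = \<nu>"
proof (rule measure_eqI_generator_eq[where E = "{S. open S}" and \<Omega> = UNIV and A = "\<lambda>_. UNIV"])
  fix U :: "'a set" assume "U \<in> {S. open S}"
  then have U: "open U" by simp
  obtain g :: "nat \<Rightarrow> 'a \<Rightarrow> real" where g: "\<And>k. continuous_on UNIV (g k)" "\<And>k x. 0 \<le> g k x"
    "\<And>k x. g k x \<le> 1" "\<And>x. incseq (\<lambda>k. g k x)" "\<And>k x. x \<notin> U \<Longrightarrow> g k x = 0"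
    "\<And>x. x \<in> U \<Longrightarrow> \<forall>\<^sub>F k in sequentially. g k x = 1"
    using metrizable_open_indicator_limit[OF metrizable U] by blast
  have app: "apply_bcontfun (Bcontfun (g k)) = g k" for k
    using g by (intro Bcontfun_inverse) (auto simp: bcontfun_def bounded_iff intro!: exI[of _ 1])
  have g_lim: "(\<lambda>k. g k x) \<longlonglongrightarrow> indicator U x" for x
  proof (cases "x \<in> U")
    case True
    then show ?thesis
      using tendsto_eventually[OF g(6)[OF True]] by simp
  qed (simp add: g(5))
  have lim: "(\<lambda>k. \<integral>x. g k x \<partial>M) \<longlonglongrightarrow> measure M U" if M: "prob_space M" "sets M = sets borel" for M
  proof -
    interpret prob_space M by fact
    have "(\<lambda>k. \<integral>x. g k x \<partial>M) \<longlonglongrightarrow> (\<integral>x. indicator U x \<partial>M)"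
    proof (rule integral_dominated_convergence[where w = "\<lambda>_. 1"])
      show "g k \<in> borel_measurable M" for k
        using g(1) M(2) by (simp cong: measurable_cong_sets add: borel_measurable_continuous_onI)
      have "U \<in> sets M" unfolding M(2) using U by (rule borel_open)
      then show "indicat_real U \<in> borel_measurable M" by (rule borel_measurable_indicator)
    qed (use g U M in \<open>auto intro!: AE_I2 g_lim\<close>)
    then show ?thesis using M U sets_eq_imp_space_eq[OF M(2)] by simp
  qed
  have "(\<integral>x. g k x \<partial>\<mu>) = (\<integral>x. g k x \<partial>\<nu>)" for k
    using eq[of "Bcontfun (g k)"] by (simp add: app)
  with lim[OF \<mu>] lim[OF \<nu>] have "measure \<mu> U = measure \<nu> U"
    using LIMSEQ_unique by fastforce
  then show "emeasure \<mu> U = emeasure \<nu> U"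
    using \<mu>(1) \<nu>(1) by (simp add: finite_measure.emeasure_eq_measure prob_space_def)
next
  show "emeasure \<mu> UNIV \<noteq> \<infinity>"
    using \<mu>(1) by (simp add: finite_measure.emeasure_eq_measure prob_space_def)
qed (auto simp: \<mu>(2) \<nu>(2) sets_borel Int_stable_def)

lemma bounded_linear_integral_bcontfun:
  fixes \<mu> :: "'a::topological_space measure"
  assumes "prob_space \<mu>" "sets \<mu> = sets borel"
  shows "bounded_linear (\<lambda>f :: 'a \<Rightarrow>\<^sub>C real. \<integral>x. apply_bcontfun f x \<partial>\<mu>)"
proof (rule bounded_linear_intro[where K = 1])
  interpret prob_space \<mu> by fact
  note int = integrable_bcontfun[OF finite_measure_axioms assms(2)]
  show "norm (\<integral>x. apply_bcontfun f x \<partial>\<mu>) \<le> norm f * 1" for f :: "'a \<Rightarrow>\<^sub>C real"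
  proof -
    have "norm (\<integral>x. apply_bcontfun f x \<partial>\<mu>) \<le> (\<integral>x. norm (apply_bcontfun f x) \<partial>\<mu>)"
      by (rule integral_norm_bound)
    also have "\<dots> \<le> norm f"
      using int abs_apply_bcontfun_le[of f] by (intro integral_le_const) auto
    finally show ?thesis by simp
  qed
qed (simp_all add: integrable_bcontfun[OF prob_space.finite_measure[OF assms(1)] assms(2)])

section \<open>Invariant measures and the Koopman operator\<close>

locale compact_metrizable_system =
  fixes T :: "'a::topological_space \<Rightarrow> 'a"
  assumes compact: "compact (UNIV :: 'a set)"
    and metrizable: "metrizable_space (euclidean :: 'a topology)"
    and continuous: "continuous_on UNIV T"
begin

definition koopman :: "('a \<Rightarrow>\<^sub>C real) \<Rightarrow> ('a \<Rightarrow>\<^sub>C real)" where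
  "koopman f = Bcontfun (apply_bcontfun f \<circ> T)"

lemma apply_koopman: "apply_bcontfun (koopman f) = apply_bcontfun f \<circ> T"
  unfolding koopman_def using continuous
  by (intro apply_Bcontfun_compact compact continuous_on_compose) auto

lemma invariant_set_iff: "invariant_set T V \<longleftrightarrow> koopman ` V \<subseteq> V"
  unfolding invariant_set_def apply_koopman[symmetric]
  by (auto simp: inj_image_mem_iff inj_def apply_bcontfun_inject)

lemma linear_koopman: "linear koopman"
  by (rule linearI; rule bcontfun_eqI) (simp_all add: apply_koopman)

text \<open>
  The coboundaries \<open>f \<circ> T - f\<close> are added to the closed invariant span so that invariance of a
  measure, too, becomes the vanishing of integrals on a linear subspace; see
  \<open>constrained_measures_iff\<close>.
\<close>
definition annihilated :: "('a \<Rightarrow>\<^sub>C real) set \<Rightarrow> ('a \<Rightarrow>\<^sub>C real) set" where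
  "annihilated C = {h + g |h g. h \<in> closed_invariant_span T C \<and> g \<in> range (\<lambda>f. koopman f - f)}"

lemma subspace_annihilated: "subspace (annihilated C)"
  unfolding annihilated_def
  by (intro subspace_sums closed_invariant_span_least(1)[OF continuous] linear_subspace_image
      linear_compose_sub linear_koopman linear_id[unfolded id_def] subspace_UNIV)

text \<open>
  Adding coboundaries creates no new positive functions up to averaging. If
  \<open>w = h + (f \<circ> T - f)\<close> is at least \<open>e > 0\<close> everywhere, then along an orbit of length \<open>n\<close> the
  coboundary telescopes and contributes at most \<open>2 * norm f\<close>, while the sum of \<open>w\<close> is at least
  \<open>n * e\<close>. For large \<open>n\<close> the orbit sum of \<open>h\<close>, which stays in the invariant span, is positive.
\<close>
lemma exists_positive_span:
  assumes w: "w \<in> annihilated C" "\<And>x. 0 < apply_bcontfun w x"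
  obtains g where "g \<in> closed_invariant_span T C" "\<And>x. 0 < apply_bcontfun g x"
proof -
  let ?H = "closed_invariant_span T C"
  obtain h f where h: "h \<in> ?H" and w_eq: "w = h + (koopman f - f)"
    using w(1) by (auto simp: annihilated_def)
  obtain x0 where x0: "\<And>x. apply_bcontfun w x0 \<le> apply_bcontfun w x"
    using continuous_attains_inf[OF compact, of "apply_bcontfun w"] by auto
  define e where "e = apply_bcontfun w x0"
  have e: "0 < e" "\<And>x. e \<le> apply_bcontfun w x" using w(2) x0 by (auto simp: e_def)
  obtain n :: nat where n: "2 * norm f < real n * e"
    using reals_Archimedean3[OF e(1)] by blast
  define g where "g = (\<Sum>k<n. (koopman ^^ k) h)"
  have app: "apply_bcontfun ((koopman ^^ k) h) x = apply_bcontfun h ((T ^^ k) x)" for k x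
    by (induction k arbitrary: x) (simp_all add: apply_koopman funpow_swap1[of T])
  have "(koopman ^^ k) h \<in> ?H" for k
    using closed_invariant_span_least(3)[OF continuous, of C] h
    by (induction k) (auto simp: invariant_set_iff)
  then have "g \<in> ?H"
    unfolding g_def by (intro subspace_sum closed_invariant_span_least(1)[OF continuous])
  moreover have "0 < apply_bcontfun g x" for x
  proof -
    let ?s = "\<lambda>k. (T ^^ k) x"
    have app_sum: "apply_bcontfun (\<Sum>k\<in>K. F k) x = (\<Sum>k\<in>K. apply_bcontfun (F k) x)"
      if "finite K" for K :: "nat set" and F :: "nat \<Rightarrow> 'a \<Rightarrow>\<^sub>C real"
      using that by (induction K) simp_all
    have "real n * e = (\<Sum>k<n. e)" by simp
    also have "\<dots> \<le> (\<Sum>k<n. apply_bcontfun w (?s k))"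
      by (intro sum_mono e)
    also have "\<dots> = (\<Sum>k<n. apply_bcontfun h (?s k)) + (\<Sum>k<n. apply_bcontfun f (?s (Suc k)) - apply_bcontfun f (?s k))"
      by (simp add: w_eq apply_koopman sum.distrib)
    also have "\<dots> = apply_bcontfun g x + (apply_bcontfun f (?s n) - apply_bcontfun f x)"
      using sum_lessThan_telescope[of "\<lambda>k. apply_bcontfun f (?s k)" n] by (simp add: g_def app_sum app)
    also have "\<dots> \<le> apply_bcontfun g x + 2 * norm f"
      using abs_apply_bcontfun_le[of f "?s n"] abs_apply_bcontfun_le[of f x] by (simp add: abs_le_iff)
    finally show ?thesis using n by simp
  qed
  ultimately show ?thesis by (rule that)
qed

lemma integral_koopman:
  assumes "prob_space \<mu>" "sets \<mu> = sets borel"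
  shows "(\<integral>x. apply_bcontfun (koopman f) x \<partial>\<mu>) = (\<integral>x. apply_bcontfun f x \<partial>distr \<mu> borel T)"
  using continuous assms(2)
  by (subst integral_distr)
    (auto cong: measurable_cong_sets simp: borel_measurable_continuous_onI apply_koopman comp_def)

lemma invariant_measures_iff:
  assumes \<mu>: "prob_space \<mu>" "sets \<mu> = sets borel"
  shows "\<mu> \<in> invariant_measures T \<longleftrightarrow>
    (\<forall>f. (\<integral>x. apply_bcontfun (koopman f) x \<partial>\<mu>) = (\<integral>x. apply_bcontfun f x \<partial>\<mu>))"
proof -
  have T: "T \<in> \<mu> \<rightarrow>\<^sub>M borel"
    using continuous \<mu>(2) by (simp cong: measurable_cong_sets add: borel_measurable_continuous_onI)
  have "\<mu> \<in> invariant_measures T \<longleftrightarrow> distr \<mu> borel T = \<mu>"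
  proof
    assume "\<mu> \<in> invariant_measures T"
    then show "distr \<mu> borel T = \<mu>"
      using \<mu>(2) T sets_eq_imp_space_eq[OF \<mu>(2)]
      by (intro measure_eqI) (auto simp: invariant_measures_def emeasure_distr)
  next
    assume eq: "distr \<mu> borel T = \<mu>"
    have "emeasure \<mu> (T -` A) = emeasure \<mu> A" if "A \<in> sets borel" for A
      using emeasure_distr[OF T that] sets_eq_imp_space_eq[OF \<mu>(2)] by (simp add: eq)
    with \<mu> show "\<mu> \<in> invariant_measures T" by (auto simp: invariant_measures_def)
  qed
  also have "\<dots> \<longleftrightarrow> (\<forall>f :: 'a \<Rightarrow>\<^sub>C real. (\<integral>x. apply_bcontfun f x \<partial>distr \<mu> borel T) = (\<integral>x. apply_bcontfun f x \<partial>\<mu>))"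
    using prob_measure_eqI[OF metrizable prob_space.prob_space_distr[OF \<mu>(1) T] _ \<mu>] by auto
  finally show ?thesis by (simp add: integral_koopman[OF \<mu>])
qed

text \<open>
  For a constrained measure the functions with vanishing integral form a closed invariant
  subspace containing \<open>C\<close>, hence contain its closed invariant span. Conversely, the coboundaries
  force invariance, because the measure and its image under \<open>T\<close> then agree on continuous
  functions.
\<close>
lemma constrained_measures_iff:
  assumes \<mu>: "prob_space \<mu>" "sets \<mu> = sets borel"
  shows "\<mu> \<in> constrained_measures T C \<longleftrightarrow>
    (\<forall>w\<in>annihilated C. (\<integral>x. apply_bcontfun w x \<partial>\<mu>) = 0)"
proof
  let ?H = "closed_invariant_span T C"
  define I where "I f = (\<integral>x. apply_bcontfun f x \<partial>\<mu>)" for f :: "'a \<Rightarrow>\<^sub>C real"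
  interpret I: bounded_linear I
    unfolding I_def using \<mu> by (rule bounded_linear_integral_bcontfun)
  {
    assume "\<mu> \<in> constrained_measures T C"
    then have C: "\<And>f. f \<in> C \<Longrightarrow> I f = 0" and inv: "\<And>f. I (koopman f) = I f"
      using invariant_measures_iff[OF \<mu>] by (auto simp: constrained_measures_def I_def)
    have "?H \<subseteq> {f. I f = 0}"
    proof (rule closed_invariant_span_least(5)[OF continuous])
      show "subspace {f. I f = 0}"
        by (auto simp: subspace_def I.add I.scaleR)
      show "closed {f. I f = 0}"
        by (intro closed_Collect_eq I.continuous_on continuous_on_id continuous_on_const)
      show "invariant_set T {f. I f = 0}"
        by (auto simp: invariant_set_iff inv)
    qed (use C in auto)
    then show "\<forall>w\<in>annihilated C. (\<integral>x. apply_bcontfun w x \<partial>\<mu>) = 0"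
      unfolding I_def[symmetric] by (auto simp: annihilated_def I.add I.diff inv)
  next
    assume zero: "\<forall>w\<in>annihilated C. (\<integral>x. apply_bcontfun w x \<partial>\<mu>) = 0"
    then have sum: "I h + (I (koopman f) - I f) = 0" if "h \<in> ?H" for h f
      using that unfolding I_def[symmetric] by (force simp: annihilated_def simp flip: I.add I.diff)
    have "I (koopman f) = I f" for f
      using sum[of 0 f] subspace_0[OF closed_invariant_span_least(1)[OF continuous]] by (simp add: I.zero)
    moreover have "I f = 0" if "f \<in> C" for f
      using sum[of f 0] closed_invariant_span_least(4)[OF continuous, of C] that
        linear_0[OF linear_koopman] by auto
    ultimately show "\<mu> \<in> constrained_measures T C"
      using invariant_measures_iff[OF \<mu>] by (auto simp: constrained_measures_def I_def)
  }
qed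

lemma constrained_measuresD:
  assumes "\<mu> \<in> constrained_measures T C"
  shows "prob_space \<mu>" "sets \<mu> = sets borel"
    and "w \<in> annihilated C \<Longrightarrow> (\<integral>x. apply_bcontfun w x \<partial>\<mu>) = 0"
proof -
  show \<mu>: "prob_space \<mu>" "sets \<mu> = sets borel"
    using assms by (auto simp: constrained_measures_def invariant_measures_def)
  show "w \<in> annihilated C \<Longrightarrow> (\<integral>x. apply_bcontfun w x \<partial>\<mu>) = 0"
    using assms constrained_measures_iff[OF \<mu>] by blast
qed

lemma span_subset_annihilated: "closed_invariant_span T C \<subseteq> annihilated C"
proof
  fix h assume "h \<in> closed_invariant_span T C"
  moreover have "h = h + (koopman 0 - 0)" by (simp add: linear_0[OF linear_koopman])
  ultimately show "h \<in> annihilated C" unfolding annihilated_def by blast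
qed

lemma no_positive_span:
  assumes \<mu>: "\<mu> \<in> constrained_measures T C" and g: "g \<in> closed_invariant_span T C"
  shows "\<exists>x. apply_bcontfun g x \<le> 0"
proof (rule ccontr)
  assume "\<not> ?thesis"
  then have pos: "\<And>x. 0 < apply_bcontfun g x" by (simp add: not_le)
  note D = constrained_measuresD[OF \<mu>]
  interpret prob_space \<mu> by (rule D(1))
  have "0 < (\<integral>x. apply_bcontfun g x \<partial>\<mu>)"
    using pos integrable_bcontfun[OF finite_measure_axioms D(2), of g]
    by (intro integral_less_AE_space[of "\<lambda>_. 0", simplified]) (auto simp: emeasure_space_1)
  with D(3)[of g] span_subset_annihilated g show False by force
qed

text \<open>
  The representing measure for \<open>upper\<close> attains the value \<open>upper \<phi>\<close>, which bounds the integral of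
  \<open>\<phi>\<close> for every constrained measure. Existence and maximality thus come from the same step.
\<close>
lemma exists_maximising_measure:
  fixes \<phi> :: "'a \<Rightarrow>\<^sub>C real"
  assumes no: "\<And>g. g \<in> closed_invariant_span T C \<Longrightarrow> \<exists>x. apply_bcontfun g x \<le> 0"
  obtains \<mu>\<^sub>0 where "\<mu>\<^sub>0 \<in> constrained_measures T C"
    "\<And>\<mu>. \<mu> \<in> constrained_measures T C \<Longrightarrow>
      (\<integral>x. apply_bcontfun \<phi> x \<partial>\<mu>) \<le> (\<integral>x. apply_bcontfun \<phi> x \<partial>\<mu>\<^sub>0)"
proof -
  interpret nonpositive_subspace "annihilated C"
  proof
    fix w assume w: "w \<in> annihilated C"
    show "\<exists>x. apply_bcontfun w x \<le> 0"
    proof (rule ccontr)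
      assume "\<not> ?thesis"
      then have "\<And>x. 0 < apply_bcontfun w x" by (simp add: not_le)
      then obtain g where "g \<in> closed_invariant_span T C" "\<And>x. 0 < apply_bcontfun g x"
        using exists_positive_span[OF w] by blast
      with no[of g] show False by (auto simp: not_le[symmetric])
    qed
  qed (rule subspace_annihilated)
  obtain \<mu>\<^sub>0 :: "'a measure" where \<mu>\<^sub>0: "prob_space \<mu>\<^sub>0" "sets \<mu>\<^sub>0 = sets borel"
    "\<And>w. w \<in> annihilated C \<Longrightarrow> (\<integral>x. apply_bcontfun w x \<partial>\<mu>\<^sub>0) = 0"
    "(\<integral>x. apply_bcontfun \<phi> x \<partial>\<mu>\<^sub>0) = upper \<phi>"
    using exists_measure[OF compact metrizable] by blast
  show ?thesis
  proof (rule that)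
    show "\<mu>\<^sub>0 \<in> constrained_measures T C"
      using constrained_measures_iff[OF \<mu>\<^sub>0(1,2)] \<mu>\<^sub>0(3) by blast
    fix \<mu> assume "\<mu> \<in> constrained_measures T C"
    note D = constrained_measuresD[OF this]
    show "(\<integral>x. apply_bcontfun \<phi> x \<partial>\<mu>) \<le> (\<integral>x. apply_bcontfun \<phi> x \<partial>\<mu>\<^sub>0)"
      unfolding \<mu>\<^sub>0(4) using D
      by (intro integral_le_upper integrable_bcontfun prob_space.finite_measure) auto
  qed
qed

end

section \<open>The duality theorem\<close>

theorem theorem1p7:
  fixes T :: "'a::topological_space \<Rightarrow> 'a"
    and C :: "('a \<Rightarrow>\<^sub>C real) set"
  assumes "compact (UNIV :: 'a set)"
    and "metrizable_space (euclidean :: 'a topology)"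
    and "continuous_on UNIV T"
  shows "(constrained_measures T C = {} \<longleftrightarrow>
           (\<exists>g\<in>closed_invariant_span T C. \<forall>x. apply_bcontfun g x > 0)) \<and>
         (constrained_measures T C \<noteq> {} \<longrightarrow>
           (\<forall>\<phi> :: 'a \<Rightarrow>\<^sub>C real. \<exists>\<mu>\<^sub>0\<in>constrained_measures T C.
              (\<integral>x. apply_bcontfun \<phi> x \<partial>\<mu>\<^sub>0) =
              (SUP \<mu>\<in>constrained_measures T C. \<integral>x. apply_bcontfun \<phi> x \<partial>\<mu>)))"
proof -
  interpret compact_metrizable_system T
    using assms by unfold_locales
  have empty_iff: "constrained_measures T C = {} \<longleftrightarrow>
      (\<exists>g\<in>closed_invariant_span T C. \<forall>x. apply_bcontfun g x > 0)"
  proof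
    assume "constrained_measures T C = {}"
    then show "\<exists>g\<in>closed_invariant_span T C. \<forall>x. apply_bcontfun g x > 0"
      using exists_maximising_measure[of C] by (metis empty_iff not_le)
  next
    assume "\<exists>g\<in>closed_invariant_span T C. \<forall>x. apply_bcontfun g x > 0"
    then show "constrained_measures T C = {}"
      using no_positive_span[of _ C] by (fastforce simp: not_le[symmetric])
  qed
  have "\<exists>\<mu>\<^sub>0\<in>constrained_measures T C. (\<integral>x. apply_bcontfun \<phi> x \<partial>\<mu>\<^sub>0) =
      (SUP \<mu>\<in>constrained_measures T C. \<integral>x. apply_bcontfun \<phi> x \<partial>\<mu>)"
    if ne: "constrained_measures T C \<noteq> {}" for \<phi> :: "'a \<Rightarrow>\<^sub>C real"
  proof -
    have no: "\<exists>x. apply_bcontfun g x \<le> 0" if "g \<in> closed_invariant_span T C" for g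
      using ne no_positive_span that by blast
    obtain \<mu>\<^sub>0 where "\<mu>\<^sub>0 \<in> constrained_measures T C"
      "\<And>\<mu>. \<mu> \<in> constrained_measures T C \<Longrightarrow>
        (\<integral>x. apply_bcontfun \<phi> x \<partial>\<mu>) \<le> (\<integral>x. apply_bcontfun \<phi> x \<partial>\<mu>\<^sub>0)"
      using exists_maximising_measure[of C \<phi>] no by blast
    then show ?thesis
      by (intro bexI[of _ \<mu>\<^sub>0] cSup_eq_maximum[symmetric]) auto
  qed
  with empty_iff show ?thesis by blast
qed

end
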